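(* On the semigroup $\mathscr{C}_{\mathbb{Z}}^{\mathbf{0}}$ (the extended bicyclic semigroup with adjoined zero) there exist a unique minimal shift-continuous topology and a unique minimal inverse semigroup topology.
   Context: The extended bicyclic semigroup is the set $\mathscr{C}_{\mathbb{Z}}=\mathbb{Z}\times\mathbb{Z}$ with the operation $(a,b)\cdot(c,d)=(a-b+c,d)$ if $b<c$; $(a,b)\cdot(c,d)=(a,d)$ if $b=c$; $(a,b)\cdot(c,d)=(a,d+b-c)$ if $b>c$. $\mathscr{C}_{\mathbb{Z}}^{\mathbf{0}}=\mathscr{C}_{\mathbb{Z}}\sqcup\{\mathbf{0}\}$ is $\mathscr{C}_{\mathbb{Z}}$ with an adjoined zero $\mathbf{0}$. It is an inverse semigroup with inversion $(a,b)^{-1}=(b,a)$, $\mathbf{0}^{-1}=\mathbf{0}$. A topology on a semigroup $S$ is shift-continuous if the multiplication is separately continuous; a topology on an inverse semigroup $S$ is an inverse semigroup topology if the multiplication is (jointly) continuous and the inversion is continuous. A Hausdorff shift-continuous (resp., inverse semigroup) topology $\tau$ on $S$ is minimal shift-continuous (resp., minimal inverse semigroup) if no Hausdorff shift-continuous (resp., inverse semigroup) topology on $S$ is strictly contained in $\tau$. *)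

theory Defs
  imports "HOL-Analysis.Analysis"
begin

class inverse_semigroup = semigroup_mult +
  fixes sinv :: "'a \<Rightarrow> 'a"
  assumes mult_sinv_mult: "x * sinv x * x = x"
    and sinv_mult_sinv: "sinv x * x * sinv x = sinv x"
    and sinv_unique: "x * y * x = x \<Longrightarrow> y * x * y = y \<Longrightarrow> y = sinv x"

text \<open>
  A topology on a semigroup is a value of the library type of topologies whose underlying set
  is the whole type. The library's type-class topologies are not used, since the topology is
  quantified over.
\<close>

definition shift_continuous :: "'a::semigroup_mult topology \<Rightarrow> bool" where
  "shift_continuous T \<longleftrightarrow>
     topspace T = UNIV \<and>
     (\<forall>a. continuous_map T T (\<lambda>x. a * x)) \<and>
     (\<forall>a. continuous_map T T (\<lambda>x. x * a))"

definition inverse_semigroup_topology :: "'a::inverse_semigroup topology \<Rightarrow> bool" where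
  "inverse_semigroup_topology T \<longleftrightarrow>
     topspace T = UNIV \<and>
     continuous_map (prod_topology T T) T (\<lambda>(x, y). x * y) \<and>
     continuous_map T T sinv"

definition strictly_coarser :: "'a topology \<Rightarrow> 'a topology \<Rightarrow> bool" where
  "strictly_coarser T' T \<longleftrightarrow> {U. openin T' U} \<subset> {U. openin T U}"

definition minimal_shift_continuous :: "'a::semigroup_mult topology \<Rightarrow> bool" where
  "minimal_shift_continuous T \<longleftrightarrow>
     Hausdorff_space T \<and> shift_continuous T \<and>
     \<not> (\<exists>T'. Hausdorff_space T' \<and> shift_continuous T' \<and> strictly_coarser T' T)"

definition minimal_inverse_semigroup :: "'a::inverse_semigroup topology \<Rightarrow> bool" where
  "minimal_inverse_semigroup T \<longleftrightarrow>
     Hausdorff_space T \<and> inverse_semigroup_topology T \<and>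
     \<not> (\<exists>T'. Hausdorff_space T' \<and> inverse_semigroup_topology T' \<and> strictly_coarser T' T)"

fun ext_bicyclic_mult :: "int \<times> int \<Rightarrow> int \<times> int \<Rightarrow> int \<times> int" where
  "ext_bicyclic_mult (a, b) (c, d) =
     (if b < c then (a - b + c, d)
      else if b = c then (a, d)
      else (a, d + b - c))"

datatype ext_bicyclic0 = Zero | Elt "int \<times> int"

instantiation ext_bicyclic0 :: "{mult_zero, inverse_semigroup}"
begin

definition zero_ext_bicyclic0 :: ext_bicyclic0 where
  "0 = Zero"

fun times_ext_bicyclic0 :: "ext_bicyclic0 \<Rightarrow> ext_bicyclic0 \<Rightarrow> ext_bicyclic0" where
  "Elt p * Elt q = Elt (ext_bicyclic_mult p q)"
| "Zero * y = Zero"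
| "Elt p * Zero = Zero"

fun sinv_ext_bicyclic0 :: "ext_bicyclic0 \<Rightarrow> ext_bicyclic0" where
  "sinv (Elt (a, b)) = Elt (b, a)"
| "sinv Zero = Zero"

instance
proof
  fix x y z :: ext_bicyclic0
  show "0 * x = 0" "x * 0 = 0"
    by (cases x; simp add: zero_ext_bicyclic0_def)+
  show "x * y * z = x * (y * z)"
    by (cases x; cases y; cases z) auto
  show "x * sinv x * x = x" "sinv x * x * sinv x = sinv x"
    by (cases x; auto)+
  show "y = sinv x" if "x * y * x = x" "y * x * y = y"
    using that by (cases x; cases y) (auto split: if_splits)
qed

end

end

theory Submission
  imports Defs
begin

text \<open>
  In a Hausdorff shift-continuous topology every nonzero element is isolated, so such a topology
  is determined by the neighbourhood filter of zero. In the shift-continuous case this filter must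
  contain all sets \<open>{x. a x b \<noteq> p}\<close> with \<open>p \<noteq> 0\<close>, and the filter generated by these sets already
  gives a Hausdorff shift-continuous topology. In the inverse semigroup case put \<open>e = (n, n)\<close>: the
  map \<open>x \<mapsto> e x (e x)\<^sup>-\<^sup>1\<close> is continuous and takes the value \<open>e\<close> exactly at the pairs \<open>(a, b)\<close> with
  \<open>a \<le> n\<close>, so zero has a neighbourhood that avoids these pairs and, dually, those with \<open>b \<le> n\<close>;
  the sets \<open>{0} \<union> {(a, b). a > n \<and> b > n}\<close> are subsemigroups closed under inversion, and they
  form a neighbourhood base for an inverse semigroup topology. Both topologies are therefore
  least, hence uniquely minimal.
\<close>

section \<open>Least topologies, and topologies with at most one non-isolated point\<close>

text \<open>A minimal \<open>T\<close> contains the least \<open>S\<close> and may not do so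
  strictly, so the two agree; exhibiting a least topology therefore suffices.\<close>

lemma ex1_minimal_topologyI:
  assumes "P S"
    and least: "\<And>T U. P T \<Longrightarrow> openin S U \<Longrightarrow> openin T U"
  shows "\<exists>!T. P T \<and> \<not> (\<exists>T'. P T' \<and> strictly_coarser T' T)"
proof (rule ex1I[of _ S])
  show "P S \<and> \<not> (\<exists>T'. P T' \<and> strictly_coarser T' S)"
    using assms unfolding strictly_coarser_def by blast
next
  fix T
  assume T: "P T \<and> \<not> (\<exists>T'. P T' \<and> strictly_coarser T' T)"
  then have "{U. openin S U} = {U. openin T U}"
    using \<open>P S\<close> least unfolding strictly_coarser_def by blast
  then show "T = S"
    by (auto simp: topology_eq)
qed

text \<open>All points other than \<open>z\<close> are isolated, and the neighbourhoods of
  \<open>z\<close> are the members of \<open>F\<close> that contain \<open>z\<close>.\<close>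

definition point_topology :: "'a \<Rightarrow> 'a filter \<Rightarrow> 'a topology" where
  "point_topology z F = topology (\<lambda>U. z \<in> U \<longrightarrow> eventually (\<lambda>x. x \<in> U) F)"

lemma openin_point_topology:
  "openin (point_topology z F) U \<longleftrightarrow> (z \<in> U \<longrightarrow> eventually (\<lambda>x. x \<in> U) F)"
proof -
  have "istopology (\<lambda>U. z \<in> U \<longrightarrow> eventually (\<lambda>x. x \<in> U) F)"
    unfolding istopology_def
  proof (intro conjI allI impI)
    fix K assume K: "\<forall>U\<in>K. z \<in> U \<longrightarrow> eventually (\<lambda>x. x \<in> U) F" "z \<in> \<Union>K"
    then obtain U where "U \<in> K" "eventually (\<lambda>x. x \<in> U) F"
      by blast
    then show "eventually (\<lambda>x. x \<in> \<Union>K) F"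
      by (auto elim: eventually_mono)
  qed (auto intro: eventually_conj)
  then show ?thesis
    by (simp add: point_topology_def topology_inverse')
qed

lemma topspace_point_topology [simp]: "topspace (point_topology z F) = UNIV"
proof -
  have "openin (point_topology z F) UNIV"
    by (simp add: openin_point_topology)
  then show ?thesis
    using openin_subset by blast
qed

text \<open>Each \<open>p\<close> other than \<open>z\<close> has a clopen singleton, and of two
  distinct points at least one is of this kind.\<close>

lemma Hausdorff_space_point_topology:
  fixes z :: 'a
  assumes "\<And>p. p \<noteq> z \<Longrightarrow> eventually (\<lambda>x. x \<noteq> p) F"
  shows "Hausdorff_space (point_topology z F)"
  unfolding Hausdorff_space_def
proof (intro allI impI, elim conjE)
  fix x y :: 'a assume "x \<noteq> y"
  define A where "A = (if x = z then - {y} else {x})"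
  define B where "B = (if x = z then {y} else - {x})"
  have "openin (point_topology z F) A" "openin (point_topology z F) B"
    using assms \<open>x \<noteq> y\<close> by (auto simp: openin_point_topology A_def B_def)
  then show "\<exists>U V. openin (point_topology z F) U \<and> openin (point_topology z F) V
      \<and> x \<in> U \<and> y \<in> V \<and> disjnt U V"
    using \<open>x \<noteq> y\<close> by (intro exI[of _ A] exI[of _ B]) (auto simp: A_def B_def disjnt_def)
qed

lemma continuous_map_point_topology:
  assumes "f z = z" "filterlim f F F"
  shows "continuous_map (point_topology z F) (point_topology z F) f"
  using assms
  by (auto simp: continuous_map_def openin_point_topology filterlim_iff)

text \<open>In the order of filters, \<open>nhdsin T z \<le> F\<close> makes every member of
  \<open>F\<close> a neighbourhood of \<open>z\<close> in \<open>T\<close>; this settles the one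
  point that isolation leaves open.\<close>

lemma openin_point_topology_imp_openin:
  assumes isolated: "\<And>x. x \<noteq> z \<Longrightarrow> openin T {x}"
    and "z \<in> topspace T" "nhdsin T z \<le> F"
    and U: "openin (point_topology z F) U"
  shows "openin T U"
proof (subst openin_subopen, intro ballI)
  fix x assume "x \<in> U"
  show "\<exists>W. openin T W \<and> x \<in> W \<and> W \<subseteq> U"
  proof (cases "x = z")
    case True
    then have "eventually (\<lambda>x. x \<in> U) (nhdsin T z)"
      using U \<open>x \<in> U\<close> \<open>nhdsin T z \<le> F\<close> by (simp add: openin_point_topology filter_leD)
    then show ?thesis
      using True \<open>z \<in> topspace T\<close> by (auto simp: eventually_nhdsin)
  next
    case False
    then show ?thesis
      using isolated \<open>x \<in> U\<close> by blast
  qed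
qed

text \<open>This turns inequalities between semigroup expressions into open sets; the leastness
  proofs exploit the Hausdorff property only in this way.\<close>

lemma openin_neq_continuous_maps:
  assumes "Hausdorff_space Y" "continuous_map X Y f" "continuous_map X Y g"
  shows "openin X {x \<in> topspace X. f x \<noteq> g x}"
proof (subst openin_subopen, intro ballI)
  fix x assume "x \<in> {x \<in> topspace X. f x \<noteq> g x}"
  then have x: "x \<in> topspace X" "f x \<in> topspace Y" "g x \<in> topspace Y" "f x \<noteq> g x"
    using assms by (auto simp: continuous_map_def)
  then obtain U V where "openin Y U" "openin Y V" "f x \<in> U" "g x \<in> V" "disjnt U V"
    using \<open>Hausdorff_space Y\<close> unfolding Hausdorff_space_def by meson
  moreover note x(1)
  moreover define W where "W = {x \<in> topspace X. f x \<in> U} \<inter> {x \<in> topspace X. g x \<in> V}"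
  moreover have "openin X W"
    unfolding W_def using assms \<open>openin Y U\<close> \<open>openin Y V\<close>
    by (blast intro: openin_Int openin_continuous_map_preimage)
  ultimately show "\<exists>W. openin X W \<and> x \<in> W \<and> W \<subseteq> {x \<in> topspace X. f x \<noteq> g x}"
    by (intro exI[of _ W]) (auto simp: disjnt_iff)
qed

section \<open>Isolation of the nonzero elements\<close>

lemma continuous_map_translations:
  assumes "shift_continuous T"
  shows "continuous_map T T (\<lambda>x. a * x)" "continuous_map T T (\<lambda>x. x * b)"
    "continuous_map T T (\<lambda>x. a * x * b)"
proof -
  show 1: "continuous_map T T (\<lambda>x. a * x)" "continuous_map T T (\<lambda>x. x * b)"
    using assms by (simp_all add: shift_continuous_def)
  show "continuous_map T T (\<lambda>x. a * x * b)"
    using continuous_map_compose[OF 1] by (simp add: o_def)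
qed

lemma mult_Zero [simp]: "x * Zero = Zero"
  by (cases x) auto

lemma openin_singleton_Elt:
  assumes H: "Hausdorff_space T" and S: "shift_continuous T"
  shows "openin T {Elt (A, B)}"
proof -
  have top: "topspace T = UNIV"
    using S by (simp add: shift_continuous_def)
  note cont = continuous_map_translations[OF S]
  \<comment> \<open>On \<open>Q\<close>, \<open>f\<close> moves a pair along its diagonal to the
    least pair with entries at least \<open>A\<close> and \<open>B\<close>; this lies in
    \<open>Q\<close> only if it is \<open>(A, B)\<close>.\<close>
  define f where "f x = Elt (A, A) * x * Elt (B, B)" for x
  \<comment> \<open>Left multiplication by \<open>Elt (k, k)\<close> fixes exactly
    \<open>Zero\<close> and the pairs with first entry at least \<open>k\<close>; right
    multiplication does the same for second entries.\<close>
  define Q where "Q = {x. Elt (A + 1, A + 1) * x \<noteq> x} \<inter> {x. x * Elt (B + 1, B + 1) \<noteq> x}"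
  \<comment> \<open>The idempotent sends each \<open>(A - k, B - k)\<close> with
    \<open>k > 0\<close> to \<open>(A - 1, B - 1)\<close>, but fixes \<open>(A, B)\<close>.\<close>
  define R where "R = {x. Elt (A - 1, A - 1) * x \<noteq> Elt (A - 1, B - 1)}"
  have "openin T {x. Elt (A + 1, A + 1) * x \<noteq> x}" "openin T {x. x * Elt (B + 1, B + 1) \<noteq> x}"
    using openin_neq_continuous_maps[OF H cont(1) continuous_map_id]
      openin_neq_continuous_maps[OF H cont(2) continuous_map_id] top by auto
  then have Q: "openin T Q"
    unfolding Q_def by (rule openin_Int)
  have "openin T R"
    using openin_neq_continuous_maps[OF H cont(1), of "\<lambda>x. Elt (A - 1, B - 1)"] top
    by (simp add: R_def)
  moreover have "openin T {x. f x \<in> Q}"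
    using openin_continuous_map_preimage[OF cont(3) Q] top by (simp add: f_def)
  ultimately have "openin T (Q \<inter> {x. f x \<in> Q} \<inter> R)"
    using Q by blast
  \<comment> \<open>\<open>Q\<close> is the quadrant \<open>{(a, b). a \<le> A \<and> b \<le> B}\<close>; its part mapped into \<open>Q\<close> by \<open>f\<close> is the
    half-diagonal through \<open>(A, B)\<close>, and \<open>R\<close> removes all of it but the end point.\<close>
  moreover have "x \<in> Q \<inter> {x. f x \<in> Q} \<inter> R \<longleftrightarrow> x \<in> {Elt (A, B)}" for x
  proof (cases x rule: ext_bicyclic0.exhaust)
    case (Elt p)
    then show ?thesis
      by (cases p) (auto simp: Q_def R_def f_def split: if_splits)
  qed (simp add: Q_def)
  ultimately show ?thesis
    by (metis subsetI subset_antisym)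
qed

lemma openin_singleton_nonzero:
  assumes "Hausdorff_space T" "shift_continuous T" "x \<noteq> Zero"
  shows "openin T {x}"
  using assms openin_singleton_Elt by (metis ext_bicyclic0.exhaust surj_pair)

section \<open>The least shift-continuous topology\<close>

definition shift_filter :: "ext_bicyclic0 filter" where
  "shift_filter = (INF (a, b, p) \<in> UNIV. principal {x. a * x * b \<noteq> Elt p})"

lemma eventually_shift_filter: "eventually (\<lambda>x. a * x * b \<noteq> Elt p) shift_filter"
proof -
  have "shift_filter \<le> principal {x. a * x * b \<noteq> Elt p}"
    unfolding shift_filter_def by (rule INF_lower2[of "(a, b, p)"]) auto
  then show ?thesis
    by (simp add: le_principal)
qed

lemma Hausdorff_shift_topology: "Hausdorff_space (point_topology Zero shift_filter)"
proof (rule Hausdorff_space_point_topology)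
  fix y :: ext_bicyclic0 assume "y \<noteq> Zero"
  then obtain A B where y: "y = Elt (A, B)"
    by (metis ext_bicyclic0.exhaust surj_pair)
  show "eventually (\<lambda>x. x \<noteq> y) shift_filter"
    \<comment> \<open>The semigroup has no unit; idempotents that fix \<open>y\<close> on either
      side take its place.\<close>
    using eventually_shift_filter[of "Elt (A, A)" "Elt (B, B)" "(A, B)"]
    by (rule eventually_mono) (auto simp: y)
qed

text \<open>Translation by \<open>c\<close> replaces the parameters \<open>a\<close>,
  \<open>b\<close> of a generating set by \<open>a * c\<close>, \<open>b\<close> or by
  \<open>a\<close>, \<open>c * b\<close>, so generators pull back to generators.\<close>

lemma shift_continuous_shift_topology: "shift_continuous (point_topology Zero shift_filter)"
proof -
  have "filterlim (\<lambda>x. c * x) shift_filter shift_filter"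
    "filterlim (\<lambda>x. x * c) shift_filter shift_filter" for c
  proof -
    show "filterlim (\<lambda>x. c * x) shift_filter shift_filter"
      by (subst (1) shift_filter_def)
        (auto simp: filterlim_INF filterlim_principal mult.assoc[symmetric] eventually_shift_filter)
    have "eventually (\<lambda>x. a * (x * c) * b \<noteq> Elt p) shift_filter" for a b p
      using eventually_shift_filter[of a "c * b" p] by (simp add: mult.assoc)
    then show "filterlim (\<lambda>x. x * c) shift_filter shift_filter"
      by (subst (1) shift_filter_def) (auto simp: filterlim_INF filterlim_principal)
  qed
  then show ?thesis
    by (auto simp: shift_continuous_def intro!: continuous_map_point_topology)
qed

lemma openin_shift_topology_imp_openin:
  assumes "Hausdorff_space T" "shift_continuous T" "openin (point_topology Zero shift_filter) U"
  shows "openin T U"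
proof (rule openin_point_topology_imp_openin[OF openin_singleton_nonzero _ _ assms(3)])
  show top: "Zero \<in> topspace T"
    using assms by (simp add: shift_continuous_def)
  have "openin T {x. a * x * b \<noteq> Elt p}" for a b p
    using openin_neq_continuous_maps[OF assms(1) continuous_map_translations(3)[OF assms(2)],
        of "\<lambda>x. Elt p"] assms(2)
    by (simp add: shift_continuous_def)
  then have "nhdsin T Zero \<le> principal {x. a * x * b \<noteq> Elt p}" for a b p
    unfolding le_principal eventually_nhdsin
    by (intro disjI2 exI[of _ "{x. a * x * b \<noteq> Elt p}"]) simp
  then show "nhdsin T Zero \<le> shift_filter"
    by (auto simp: shift_filter_def intro!: INF_greatest)
qed (use assms in auto)

section \<open>The least inverse semigroup topology\<close>

text \<open>Makes the isolation of nonzero elements available for inverse semigroup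
  topologies.\<close>

lemma inverse_semigroup_topology_imp_shift_continuous:
  assumes "inverse_semigroup_topology T"
  shows "shift_continuous T"
proof -
  have top: "topspace T = UNIV"
    and mult: "continuous_map (prod_topology T T) T (\<lambda>(x, y). x * y)"
    using assms by (auto simp: inverse_semigroup_topology_def)
  have "continuous_map T T (\<lambda>x. a * x)" "continuous_map T T (\<lambda>x. x * a)" for a
    using continuous_map_compose[OF _ mult, of T "\<lambda>x. (a, x)"]
      continuous_map_compose[OF _ mult, of T "\<lambda>x. (x, a)"] top
    by (simp_all add: continuous_map_pairwise o_def)
  then show ?thesis
    using top by (simp add: shift_continuous_def)
qed

definition quadrant_filter :: "ext_bicyclic0 filter" where
  "quadrant_filter = (INF n. principal (insert Zero {Elt (a, b) | a b. n < a \<and> n < b}))"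

lemma eventually_quadrant_filter:
  "eventually P quadrant_filter \<longleftrightarrow> (\<exists>n. P Zero \<and> (\<forall>a b. n < a \<longrightarrow> n < b \<longrightarrow> P (Elt (a, b))))"
  unfolding quadrant_filter_def
proof (subst eventually_INF_base)
  fix m n :: int
  show "\<exists>k\<in>UNIV. principal (insert Zero {Elt (a, b) | a b. k < a \<and> k < b})
      \<le> inf (principal (insert Zero {Elt (a, b) | a b. m < a \<and> m < b}))
          (principal (insert Zero {Elt (a, b) | a b. n < a \<and> n < b}))"
    by (rule bexI[of _ "max m n"]) auto
qed (auto simp: eventually_principal)

lemma Hausdorff_quadrant_topology: "Hausdorff_space (point_topology Zero quadrant_filter)"
proof (rule Hausdorff_space_point_topology)
  fix y :: ext_bicyclic0 assume "y \<noteq> Zero"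
  then obtain A B where "y = Elt (A, B)"
    by (metis ext_bicyclic0.exhaust surj_pair)
  then show "eventually (\<lambda>x. x \<noteq> y) quadrant_filter"
    by (auto simp: eventually_quadrant_filter intro!: exI[of _ A])
qed

lemma filterlim_quadrant_filter_translations:
  "filterlim (\<lambda>x. c * x) quadrant_filter quadrant_filter"
  "filterlim (\<lambda>x. x * c) quadrant_filter quadrant_filter"
proof -
  have "eventually (\<lambda>x. P (c * x)) quadrant_filter \<and> eventually (\<lambda>x. P (x * c)) quadrant_filter"
    if "eventually P quadrant_filter" for P
  proof (cases c rule: ext_bicyclic0.exhaust)
    case (Elt p)
    then obtain r s where c: "c = Elt (r, s)"
      by (cases p) auto
    obtain n where "P Zero" "\<And>a b. n < a \<Longrightarrow> n < b \<Longrightarrow> P (Elt (a, b))"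
      using \<open>eventually P quadrant_filter\<close> unfolding eventually_quadrant_filter by blast
    \<comment> \<open>Beyond the bound chosen here the products are \<open>(r - s + a, b)\<close>
      and \<open>(a, s - r + b)\<close>, and their entries still exceed \<open>n\<close>.\<close>
    then show ?thesis
      by (auto simp: c eventually_quadrant_filter
          intro!: exI[of _ "\<bar>n\<bar> + \<bar>r\<bar> + \<bar>s\<bar>"])
  qed (use that in \<open>auto simp: eventually_quadrant_filter\<close>)
  then show "filterlim (\<lambda>x. c * x) quadrant_filter quadrant_filter"
    "filterlim (\<lambda>x. x * c) quadrant_filter quadrant_filter"
    by (simp_all add: filterlim_iff)
qed

text \<open>A nonzero factor is isolated, so continuity there is that of a translation. At
  \<open>(Zero, Zero)\<close> it holds because a nonzero product has first entry at least that of
  its left factor and second entry at least that of its right factor.\<close>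

lemma inverse_semigroup_quadrant_topology:
  "inverse_semigroup_topology (point_topology Zero quadrant_filter)"
  (is "inverse_semigroup_topology ?T")
proof -
  note cont = continuous_map_point_topology[of _ Zero,
      OF _ filterlim_quadrant_filter_translations(1)]
    continuous_map_point_topology[of _ Zero, OF _ filterlim_quadrant_filter_translations(2)]
  have single: "openin ?T {Elt p}" for p
    by (simp add: openin_point_topology)
  have "\<exists>U V. openin ?T U \<and> openin ?T V \<and> x \<in> U \<and> y \<in> V \<and> (\<forall>u\<in>U. \<forall>v\<in>V. u * v \<in> W)"
    if W: "openin ?T W" "x * y \<in> W" for x y W
  proof (cases x rule: ext_bicyclic0.exhaust)
    case (Elt p)
    have "openin ?T {v. Elt p * v \<in> W}"
      using openin_continuous_map_preimage[OF cont(1) W(1)] by simp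
    then show ?thesis
      using single[of p] W Elt by (intro exI[of _ "{Elt p}"] exI[of _ "{v. Elt p * v \<in> W}"]) auto
  next
    case x: Zero
    show ?thesis
    proof (cases y rule: ext_bicyclic0.exhaust)
      case (Elt p)
      have "openin ?T {v. v * Elt p \<in> W}"
        using openin_continuous_map_preimage[OF cont(2) W(1)] by simp
      then show ?thesis
        using single[of p] W Elt
        by (intro exI[of _ "{v. v * Elt p \<in> W}"] exI[of _ "{Elt p}"]) auto
    next
      case y: Zero
      obtain n where n: "Zero \<in> W" "\<And>a b. n < a \<Longrightarrow> n < b \<Longrightarrow> Elt (a, b) \<in> W"
        using W x y by (auto simp: openin_point_topology eventually_quadrant_filter)
      define V where "V = insert Zero {Elt (a, b) | a b. n < a \<and> n < b}"
      have "openin ?T V"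
        by (auto simp: V_def openin_point_topology eventually_quadrant_filter)
      moreover have "\<forall>u\<in>V. \<forall>v\<in>V. u * v \<in> W"
        using n by (auto simp: V_def)
      ultimately show ?thesis
        using x y by (intro exI[of _ V]) (auto simp: V_def)
    qed
  qed
  then have "continuous_map (prod_topology ?T ?T) ?T (\<lambda>(x, y). x * y)"
    unfolding continuous_map_def openin_prod_topology_alt by (fastforce simp: subset_iff)
  moreover have "filterlim sinv quadrant_filter quadrant_filter"
    by (auto simp: filterlim_iff eventually_quadrant_filter)
  then have "continuous_map ?T ?T sinv"
    by (intro continuous_map_point_topology) auto
  ultimately show ?thesis
    by (simp add: inverse_semigroup_topology_def)
qed

lemma openin_quadrant_topology_imp_openin:
  assumes H: "Hausdorff_space T" and I: "inverse_semigroup_topology T"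
    and U: "openin (point_topology Zero quadrant_filter) U"
  shows "openin T U"
proof (rule openin_point_topology_imp_openin[OF openin_singleton_nonzero _ _ U])
  have top: "topspace T = UNIV"
    and mult: "continuous_map (prod_topology T T) T (\<lambda>(x, y). x * y)"
    and inv: "continuous_map T T sinv"
    using I by (auto simp: inverse_semigroup_topology_def)
  show S: "shift_continuous T"
    using I by (rule inverse_semigroup_topology_imp_shift_continuous)
  note cont = continuous_map_translations[OF S]
  have mult': "continuous_map T T (\<lambda>x. f x * g x)"
    if "continuous_map T T f" "continuous_map T T g" for f g
    using continuous_map_compose[OF continuous_map_pairedI[OF that] mult] by (simp add: o_def)
  have inv': "continuous_map T T (\<lambda>x. sinv (f x))" if "continuous_map T T f" for f
    using continuous_map_compose[OF that inv] by (simp add: o_def)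
  show "nhdsin T Zero \<le> quadrant_filter"
    unfolding quadrant_filter_def
  proof (rule INF_greatest)
    fix n :: int
    define e where "e = Elt (n, n)"
    \<comment> \<open>For \<open>y = Elt (c, d)\<close>, \<open>y * sinv y\<close> is
      \<open>Elt (c, c)\<close> and \<open>sinv y * y\<close> is \<open>Elt (d, d)\<close>. As
      \<open>e * x\<close> has first entry \<open>max n a\<close> and \<open>x * e\<close> has
      second entry \<open>max n b\<close>, the conditions say \<open>n < a\<close> and
      \<open>n < b\<close>.\<close>
    define W where "W = {x. (e * x) * sinv (e * x) \<noteq> e} \<inter> {x. sinv (x * e) * (x * e) \<noteq> e}"
    have "openin T {x. (e * x) * sinv (e * x) \<noteq> e}" "openin T {x. sinv (x * e) * (x * e) \<noteq> e}"
      using openin_neq_continuous_maps[OF H mult'[OF cont(1) inv'[OF cont(1)]], of "\<lambda>_. e"]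
        openin_neq_continuous_maps[OF H mult'[OF inv'[OF cont(2)] cont(2)], of "\<lambda>_. e"] top
      by simp_all
    then have "openin T W"
      unfolding W_def by (rule openin_Int)
    moreover have "Zero \<in> W"
      by (simp add: W_def e_def)
    moreover have "x \<in> insert Zero {Elt (a, b) | a b. n < a \<and> n < b}" if "x \<in> W" for x
    proof (cases x rule: ext_bicyclic0.exhaust)
      case (Elt p)
      then show ?thesis
        using that by (cases p) (auto simp: W_def e_def split: if_splits)
    qed simp
    ultimately show "nhdsin T Zero \<le> principal (insert Zero {Elt (a, b) | a b. n < a \<and> n < b})"
      unfolding le_principal eventually_nhdsin by blast
  qed
  show "Zero \<in> topspace T"
    by (simp add: top)
qed (use H in auto)

theorem mainTheorem5:
  "(\<exists>!T :: ext_bicyclic0 topology. minimal_shift_continuous T) \<and>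
   (\<exists>!T :: ext_bicyclic0 topology. minimal_inverse_semigroup T)"
  \<comment> \<open>Reassociating joins the Hausdorff and continuity conditions into the single
    predicate \<open>P\<close> of \<open>ex1_minimal_topologyI\<close>.\<close>
  unfolding minimal_shift_continuous_def minimal_inverse_semigroup_def conj_assoc[symmetric]
proof (rule conjI)
  show "\<exists>!T :: ext_bicyclic0 topology. (Hausdorff_space T \<and> shift_continuous T) \<and>
      \<not> (\<exists>T'. (Hausdorff_space T' \<and> shift_continuous T') \<and> strictly_coarser T' T)"
    by (rule ex1_minimal_topologyI[where S = "point_topology Zero shift_filter"])
      (use Hausdorff_shift_topology shift_continuous_shift_topology
        openin_shift_topology_imp_openin in blast)+
  show "\<exists>!T :: ext_bicyclic0 topology. (Hausdorff_space T \<and> inverse_semigroup_topology T) \<and>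
      \<not> (\<exists>T'. (Hausdorff_space T' \<and> inverse_semigroup_topology T') \<and> strictly_coarser T' T)"
    by (rule ex1_minimal_topologyI[where S = "point_topology Zero quadrant_filter"])
      (use Hausdorff_quadrant_topology inverse_semigroup_quadrant_topology
        openin_quadrant_topology_imp_openin in blast)+
qed

end
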